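(* Let $X$ be a discrete log-concave random variable. If $\mathbb{E}[X]\in\mathbb{Z}$, then $$\mathbb{P}(X\leq \mathbb{E}[X]) \geq e^{-1}.$$
   Context: An integer-valued random variable $X$ with probability mass function $p(k)=\mathbb{P}(X=k)$, $k\in\mathbb{Z}$, is called (discrete) log-concave if $p(k)^2 \geq p(k-1)\,p(k+1)$ for all $k\in\mathbb{Z}$ and $X$ has contiguous support, meaning that $\{k\in\mathbb{Z} : p(k)>0\}$ is a set of consecutive integers (finite or infinite in either direction). *)

theory Defs
  imports "HOL-Probability.Probability"
begin

definition int_pmf :: "'a measure \<Rightarrow> ('a \<Rightarrow> int) \<Rightarrow> int \<Rightarrow> real" where
  "int_pmf M X k = measure M {\<omega> \<in> space M. X \<omega> = k}"

definition consecutive_ints :: "int set \<Rightarrow> bool" where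
  "consecutive_ints S \<longleftrightarrow> (\<forall>i\<in>S. \<forall>k\<in>S. \<forall>j. i \<le> j \<and> j \<le> k \<longrightarrow> j \<in> S)"

definition discrete_log_concave :: "'a measure \<Rightarrow> ('a \<Rightarrow> int) \<Rightarrow> bool" where
  "discrete_log_concave M X \<longleftrightarrow>
     (\<forall>k. (int_pmf M X k)\<^sup>2 \<ge> int_pmf M X (k - 1) * int_pmf M X (k + 1)) \<and>
     consecutive_ints {k. int_pmf M X k > 0}"

end

theory Submission
  imports Defs
begin

text \<open>
  In the continuous case the bound is Jensen's inequality: the distribution function \<open>F\<close> of a
  log-concave variable is log-concave and \<open>F(X)\<close> is uniform on \<open>[0,1]\<close>, so
  \<open>ln (F (E X)) \<ge> E (ln (F X)) = \<integral>\<^sub>0\<^sup>1 ln u du = - 1\<close>.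

  This survives discretisation. Let \<open>F k = P(X \<le> k)\<close>. Summing the inequalities
  \<open>p l * p (k + 1) \<le> p (l + 1) * p k\<close> (\<open>log_concave_ratio\<close>) over \<open>l < k\<close> shows that \<open>F\<close> is a
  log-concave sequence (\<open>log_concave_cdf\<close>). Since \<open>m = E X\<close> is an integer, \<open>ln F\<close> lies below a
  line that touches it at \<open>m\<close> (\<open>log_concave_supporting_line\<close>), and averaging against \<open>p\<close> gives
  \<open>E (ln (F X)) \<le> ln (F m)\<close>. On the other hand
  \<open>E (ln (F X)) = (\<Sum>k. (F k - F (k - 1)) * ln (F k))\<close> is an upper Riemann sum of the increasing
  function \<open>ln\<close> on \<open>[0,1]\<close>, hence at least \<open>- 1\<close>; with the antiderivative \<open>u * ln u - u\<close> this is
  a telescoping estimate (\<open>ln_upper_rectangle\<close>).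

  Both estimates are applied to the window \<open>{- N..N}\<close> before \<open>N\<close> tends to infinity, so that the
  expectation of \<open>ln (F X)\<close> itself never occurs. The limit requires \<open>X\<close> to be integrable, which
  holds because a summable log-concave sequence has geometrically decaying tails
  (\<open>log_concave_summable_moment\<close>).
\<close>

section \<open>Log-concave sequences\<close>

text \<open>
  Along the support the ratios \<open>p (k + 1) / p k\<close> decrease. Contiguity of the support is what
  allows the local inequalities to be chained: no index between \<open>l\<close> and \<open>k + 1\<close> can be a zero
  when both ends are positive.
\<close>

lemma log_concave_ratio:
  fixes p :: "int \<Rightarrow> real"
  assumes nonneg: "\<And>k. 0 \<le> p k"
    and log_concave: "\<And>k. p (k - 1) * p (k + 1) \<le> (p k)\<^sup>2"
    and contiguous: "consecutive_ints {k. 0 < p k}"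
    and "l \<le> k"
  shows "p l * p (k + 1) \<le> p (l + 1) * p k"
  using \<open>l \<le> k\<close>
proof (induction k rule: int_ge_induct)
  case base
  then show ?case by simp
next
  case (step k)
  show ?case
  proof (cases "p l = 0 \<or> p (k + 1 + 1) = 0")
    case True
    then show ?thesis using nonneg by auto
  next
    case False
    then have "0 < p l" "0 < p (k + 1 + 1)"
      using nonneg by (simp_all add: order_less_le)
    with contiguous \<open>l \<le> k\<close> have pos: "0 < p k"
      unfolding consecutive_ints_def by (smt (verit) mem_Collect_eq)
    have "p l * p (k + 1 + 1) * p k = p l * (p (k + 1 - 1) * p (k + 1 + 1))"
      by simp
    also have "\<dots> \<le> p l * (p (k + 1))\<^sup>2"
      by (intro mult_left_mono log_concave nonneg)
    also have "\<dots> = (p l * p (k + 1)) * p (k + 1)"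
      by (simp add: power2_eq_square)
    also have "\<dots> \<le> (p (l + 1) * p k) * p (k + 1)"
      by (intro mult_right_mono step.IH nonneg)
    finally have "p l * p (k + 1 + 1) * p k \<le> p (l + 1) * p (k + 1) * p k"
      by (simp add: mult_ac)
    then show ?thesis using pos by simp
  qed
qed

text \<open>
  A nonnegative sequence that tends to \<open>0\<close> without being identically \<open>0\<close> must decrease strictly at some step \<open>n0\<close>, and
  the ratio at that step dominates all later ratios.
\<close>

lemma log_concave_summable_moment:
  fixes q :: "nat \<Rightarrow> real"
  assumes nonneg: "\<And>n. 0 \<le> q n"
    and ratio: "\<And>n m. n \<le> m \<Longrightarrow> q n * q (Suc m) \<le> q (Suc n) * q m"
    and summable: "summable q"
  shows "summable (\<lambda>n. real n * q n)"
proof (cases "\<forall>n. q n = 0")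
  case True
  then show ?thesis by simp
next
  case False
  then obtain n1 where n1: "0 < q n1"
    using nonneg by (metis order_less_le)
  have "\<exists>n0. q (Suc n0) < q n0"
  proof (rule ccontr)
    assume "\<not> ?thesis"
    then have "incseq q" by (intro incseq_SucI) (simp add: not_less)
    moreover have "q \<longlonglongrightarrow> 0" using summable by (rule summable_LIMSEQ_zero)
    ultimately have "q n1 \<le> 0" by (rule incseq_le)
    with n1 show False by simp
  qed
  then obtain n0 where n0: "q (Suc n0) < q n0" ..
  then have pos: "0 < q n0" using nonneg[of "Suc n0"] by linarith
  define r where "r = q (Suc n0) / q n0"
  have r: "0 \<le> r" "r < 1" using nonneg n0 pos by (simp_all add: r_def)
  have step: "q (Suc m) \<le> r * q m" if "n0 \<le> m" for m
    using ratio[OF that] pos by (simp add: r_def field_simps)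
  have geometric: "q (n + n0) \<le> q n0 * r ^ n" for n
  proof (induction n)
    case (Suc n)
    have "q (Suc n + n0) \<le> r * q (n + n0)" using step[of "n + n0"] by simp
    also have "\<dots> \<le> r * (q n0 * r ^ n)" using Suc r by (intro mult_left_mono) auto
    finally show ?case by (simp add: mult_ac)
  qed simp
  have "summable (\<lambda>n. real (Suc n) * r ^ n)"
    using geometric_deriv_sums[of r] r by (simp add: sums_iff)
  then have majorant: "summable (\<lambda>n. (real (Suc n0) * q n0) * (real (Suc n) * r ^ n))"
    by (rule summable_mult)
  have "summable (\<lambda>n. real (n + n0) * q (n + n0))"
  proof (rule summable_comparison_test[OF _ majorant], intro exI allI impI)
    fix n
    have "real (n + n0) \<le> real (Suc n0) * real (Suc n)"
      by (simp add: algebra_simps)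
    then have "real (n + n0) * q (n + n0) \<le> (real (Suc n0) * real (Suc n)) * (q n0 * r ^ n)"
      using geometric[of n] nonneg by (intro mult_mono) auto
    then show "norm (real (n + n0) * q (n + n0)) \<le> real (Suc n0) * q n0 * (real (Suc n) * r ^ n)"
      using nonneg by (simp add: mult_ac)
  qed
  then show ?thesis by (subst (asm) summable_iff_shift)
qed

text \<open>
  For a sequence with decreasing ratios the slope of the line is the logarithm of the single ratio
  \<open>F (m + 1) / F m\<close>, which dominates all ratios to the right of \<open>m\<close> and is dominated by all ratios to
  the left. The multiplicative form allows \<open>F\<close> to vanish far to the left.
\<close>

lemma log_concave_supporting_line:
  fixes F :: "int \<Rightarrow> real"
  assumes ratio: "\<And>l k. l \<le> k \<Longrightarrow> F l * F (k + 1) \<le> F (l + 1) * F k"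
    and pos: "0 < F m" "0 < F (m + 1)"
  obtains c where "\<And>k. F k \<le> F m * exp (c * real_of_int (k - m))"
proof -
  define c where "c = ln (F (m + 1) / F m)"
  have c: "exp c = F (m + 1) / F m" using pos by (simp add: c_def)
  have "F k \<le> F m * exp (c * real_of_int (k - m))" for k
  proof (induction k rule: int_induct[of _ m])
    case base
    then show ?case by simp
  next
    case (step1 k)
    have "F (k + 1) \<le> exp c * F k"
      using ratio[OF step1(1)] pos by (simp add: c field_simps)
    also have "\<dots> \<le> exp c * (F m * exp (c * real_of_int (k - m)))"
      using step1 by (intro mult_left_mono) auto
    also have "\<dots> = F m * exp (c * real_of_int (k + 1 - m))"
      by (simp add: algebra_simps flip: exp_add)
    finally show ?case .
  next
    case (step2 k)
    have "F (k - 1) \<le> exp (- c) * F k"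
      using ratio[of "k - 1" m] step2(1) pos by (simp add: c exp_minus field_simps)
    also have "\<dots> \<le> exp (- c) * (F m * exp (c * real_of_int (k - m)))"
      using step2 by (intro mult_left_mono) auto
    also have "\<dots> = F m * exp (c * real_of_int (k - 1 - m))"
      by (simp add: algebra_simps flip: exp_add)
    finally show ?case .
  qed
  then show ?thesis by (rule that)
qed

section \<open>The entropy estimate\<close>

text \<open>
  The area under \<open>ln\<close> over \<open>[a, b]\<close> is at most that of the rectangle of height \<open>ln b\<close>. The value
  \<open>ln 0 = 0\<close> of the library makes the antiderivative \<open>u * ln u - u\<close> continuous at \<open>0\<close> from the
  right, so \<open>a = 0\<close> is included.
\<close>

lemma ln_upper_rectangle:
  fixes a b :: real
  assumes "0 \<le> a" "a \<le> b"
  shows "(b * ln b - b) - (a * ln a - a) \<le> (b - a) * ln b"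
proof (cases "a = 0")
  case True
  then show ?thesis using assms by simp
next
  case False
  with assms have "0 < a" "0 < b" by auto
  then have "a * ln (b / a) \<le> a * (b / a - 1)"
    by (intro mult_left_mono ln_le_minus_one) auto
  then show ?thesis
    using \<open>0 < a\<close> \<open>0 < b\<close> by (simp add: ln_div algebra_simps)
qed

lemma sum_int_telescope:
  fixes g :: "int \<Rightarrow> 'b::ab_group_add"
  assumes "a \<le> b"
  shows "(\<Sum>k\<in>{a..b}. g k - g (k - 1)) = g b - g (a - 1)"
  using assms
proof (induction b rule: int_ge_induct)
  case (step b)
  then have "{a..b + 1} = insert (b + 1) {a..b}" by auto
  then show ?case using step by simp
qed simp

lemma tendsto_times_ln_at_0:
  fixes f :: "nat \<Rightarrow> real"
  assumes "f \<longlonglongrightarrow> 0" "\<And>n. 0 \<le> f n"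
  shows "(\<lambda>n. f n * ln (f n)) \<longlonglongrightarrow> 0"
proof -
  have "((\<lambda>u::real. u * ln u) \<longlongrightarrow> 0) (at_right 0)"
    by real_asymp
  then have "((\<lambda>u::real. u * ln u) \<longlongrightarrow> 0 * ln 0) (at 0 within {0..})"
    by (simp add: at_within_Ici_at_right)
  then have "continuous (at 0 within {0..}) (\<lambda>u::real. u * ln u)"
    by (simp add: continuous_within)
  from continuous_within_tendsto_compose'[OF this _ assms(1)] assms(2)
  show ?thesis by simp
qed

section \<open>Integer-valued random variables\<close>

context prob_space
begin

lemma int_pmf_nonneg: "0 \<le> int_pmf M X k"
  by (simp add: int_pmf_def)

lemma integral_window:
  fixes X :: "'a \<Rightarrow> int" and f :: "int \<Rightarrow> real"
  assumes [measurable]: "X \<in> measurable M (count_space UNIV)" and "finite S"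
  shows "integrable M (\<lambda>\<omega>. f (X \<omega>) * indicator S (X \<omega>))"
    and "expectation (\<lambda>\<omega>. f (X \<omega>) * indicator S (X \<omega>)) = (\<Sum>k\<in>S. f k * int_pmf M X k)"
proof -
  have eq: "f (X \<omega>) * indicator S (X \<omega>)
      = (\<Sum>k\<in>S. f k * indicator {\<omega> \<in> space M. X \<omega> = k} \<omega>)" if "\<omega> \<in> space M" for \<omega>
    using that \<open>finite S\<close> by (auto simp: indicator_def sum.delta' if_distrib cong: if_cong)
  have int: "integrable M (\<lambda>\<omega>. \<Sum>k\<in>S. f k * indicator {\<omega> \<in> space M. X \<omega> = k} \<omega>)"
    by (intro Bochner_Integration.integrable_sum integrable_mult_right integrable_real_indicator)
      (auto simp: emeasure_eq_measure)
  show "integrable M (\<lambda>\<omega>. f (X \<omega>) * indicator S (X \<omega>))"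
    using int by (rule Bochner_Integration.integrable_cong[THEN iffD2, rotated 2]) (auto simp: eq)
  have "expectation (\<lambda>\<omega>. f (X \<omega>) * indicator S (X \<omega>))
      = expectation (\<lambda>\<omega>. \<Sum>k\<in>S. f k * indicator {\<omega> \<in> space M. X \<omega> = k} \<omega>)"
    by (intro Bochner_Integration.integral_cong refl eq)
  also have "\<dots> = (\<Sum>k\<in>S. f k * int_pmf M X k)"
    by (subst Bochner_Integration.integral_sum)
      (auto simp: int_pmf_def emeasure_eq_measure intro!: integrable_real_indicator)
  finally show "expectation (\<lambda>\<omega>. f (X \<omega>) * indicator S (X \<omega>)) = (\<Sum>k\<in>S. f k * int_pmf M X k)" .
qed

lemma tendsto_indicator_window:
  "(\<lambda>N. y * indicator {- int N..int N} x :: real) \<longlonglongrightarrow> y"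
proof (rule tendsto_eventually, rule eventually_sequentiallyI)
  fix N assume "nat \<bar>x\<bar> \<le> N"
  then have "x \<in> {- int N..int N}" by auto
  then show "y * indicator {- int N..int N} x = y" by simp
qed

lemma tendsto_sum_window:
  fixes X :: "'a \<Rightarrow> int" and f :: "int \<Rightarrow> real"
  assumes X [measurable]: "X \<in> measurable M (count_space UNIV)"
    and int: "integrable M (\<lambda>\<omega>. f (X \<omega>))"
  shows "(\<lambda>N. \<Sum>k\<in>{- int N..int N}. f k * int_pmf M X k) \<longlonglongrightarrow> expectation (\<lambda>\<omega>. f (X \<omega>))"
proof -
  have "(\<lambda>N. expectation (\<lambda>\<omega>. f (X \<omega>) * indicator {- int N..int N} (X \<omega>)))
      \<longlonglongrightarrow> expectation (\<lambda>\<omega>. f (X \<omega>))"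
  proof (rule integral_dominated_convergence[where w = "\<lambda>\<omega>. norm (f (X \<omega>))"])
    show "integrable M (\<lambda>\<omega>. norm (f (X \<omega>)))" using int by simp
    show "AE \<omega> in M. (\<lambda>N. f (X \<omega>) * indicator {- int N..int N} (X \<omega>)) \<longlonglongrightarrow> f (X \<omega>)"
      by (intro AE_I2 tendsto_indicator_window)
    show "AE \<omega> in M. norm (f (X \<omega>) * indicator {- int N..int N} (X \<omega>)) \<le> norm (f (X \<omega>))" for N
      by (auto simp: indicator_def)
    show "(\<lambda>\<omega>. f (X \<omega>) * indicator {- int N..int N} (X \<omega>)) \<in> borel_measurable M" for N
      by (intro borel_measurable_integrable integral_window(1) X) simp
    show "(\<lambda>\<omega>. f (X \<omega>)) \<in> borel_measurable M" using int by simp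
  qed
  then show ?thesis by (simp add: integral_window[OF X])
qed

lemma int_pmf_sum_le_prob:
  fixes X :: "'a \<Rightarrow> int"
  assumes [measurable]: "X \<in> measurable M (count_space UNIV)" and "finite S"
  shows "(\<Sum>k\<in>S. int_pmf M X k) \<le> prob {\<omega> \<in> space M. X \<omega> \<in> S}"
proof -
  have "(\<Sum>k\<in>S. int_pmf M X k) = expectation (\<lambda>\<omega>. 1 * indicator S (X \<omega>))"
    using integral_window(2)[OF assms, of "\<lambda>_. 1"] by simp
  also have "\<dots> = expectation (indicator {\<omega> \<in> space M. X \<omega> \<in> S})"
    by (intro Bochner_Integration.integral_cong) (auto simp: indicator_def)
  finally show ?thesis by simp
qed

lemma summable_int_pmf:
  fixes X :: "'a \<Rightarrow> int" and g :: "nat \<Rightarrow> int"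
  assumes [measurable]: "X \<in> measurable M (count_space UNIV)" and "inj g"
  shows "summable (\<lambda>n. int_pmf M X (g n))"
proof (rule summableI_nonneg_bounded[where x = 1])
  fix n
  have "(\<Sum>i<n. int_pmf M X (g i)) = (\<Sum>k\<in>g ` {..<n}. int_pmf M X k)"
    using \<open>inj g\<close> by (subst sum.reindex) (auto intro: inj_on_subset)
  also have "\<dots> \<le> prob {\<omega> \<in> space M. X \<omega> \<in> g ` {..<n}}"
    by (intro int_pmf_sum_le_prob assms) auto
  also have "\<dots> \<le> 1" by simp
  finally show "(\<Sum>i<n. int_pmf M X (g i)) \<le> 1" .
qed (rule int_pmf_nonneg)

lemma int_pmf_ratio:
  assumes "discrete_log_concave M X" "l \<le> k"
  shows "int_pmf M X l * int_pmf M X (k + 1) \<le> int_pmf M X (l + 1) * int_pmf M X k"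
  using assms by (intro log_concave_ratio int_pmf_nonneg) (auto simp: discrete_log_concave_def)

text \<open>
  The decay of the left tail is that of the right tail of the reflected sequence
  \<open>k \<mapsto> p (- k)\<close>, for which the ratio inequality has the same form.
\<close>

lemma log_concave_integrable:
  fixes X :: "'a \<Rightarrow> int"
  assumes X [measurable]: "X \<in> measurable M (count_space UNIV)"
    and dlc: "discrete_log_concave M X"
  shows "integrable M (\<lambda>\<omega>. real_of_int (X \<omega>))"
proof -
  let ?p = "int_pmf M X"
  have "summable (\<lambda>n. real n * ?p (int n))"
  proof (rule log_concave_summable_moment)
    show "?p (int n) * ?p (int (Suc m)) \<le> ?p (int (Suc n)) * ?p (int m)" if "n \<le> m" for n m
      using int_pmf_ratio[OF dlc, of "int n" "int m"] that by (simp add: add.commute)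
  qed (auto intro!: int_pmf_nonneg summable_int_pmf X)
  moreover have "summable (\<lambda>n. real n * ?p (- int n))"
  proof (rule log_concave_summable_moment)
    show "?p (- int n) * ?p (- int (Suc m)) \<le> ?p (- int (Suc n)) * ?p (- int m)"
      if "n \<le> m" for n m
      using int_pmf_ratio[OF dlc, of "- int (Suc m)" "- int (Suc n)"] that
      by (simp add: mult.commute)
  qed (auto intro!: int_pmf_nonneg summable_int_pmf X injI)
  ultimately have "summable (\<lambda>n. real n * ?p (int n) + real n * ?p (- int n))"
    by (rule summable_add)
  then have lim: "(\<lambda>N. \<Sum>n\<le>N. real n * ?p (int n) + real n * ?p (- int n))
      \<longlonglongrightarrow> (\<Sum>n. real n * ?p (int n) + real n * ?p (- int n))"
    by (rule summable_LIMSEQ')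
  have fold: "(\<Sum>k\<in>{- int N..int N}. real_of_int \<bar>k\<bar> * ?p k)
      = (\<Sum>n\<le>N. real n * ?p (int n) + real n * ?p (- int n))" for N
  proof (induction N)
    case (Suc N)
    have "{- int (Suc N)..int (Suc N)}
        = insert (int (Suc N)) (insert (- int (Suc N)) {- int N..int N})"
      by auto
    then show ?case using Suc by simp
  qed simp
  have "integrable M (\<lambda>\<omega>. real_of_int \<bar>X \<omega>\<bar>)"
  proof (rule integrable_monotone_convergence)
    show "integrable M (\<lambda>\<omega>. real_of_int \<bar>X \<omega>\<bar> * indicator {- int N..int N} (X \<omega>))" for N
      by (rule integral_window(1)[OF X]) simp
    show "AE \<omega> in M. mono (\<lambda>N. real_of_int \<bar>X \<omega>\<bar> * indicator {- int N..int N} (X \<omega>))"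
      by (auto simp: mono_def indicator_def)
    show "AE \<omega> in M. (\<lambda>N. real_of_int \<bar>X \<omega>\<bar> * indicator {- int N..int N} (X \<omega>))
        \<longlonglongrightarrow> real_of_int \<bar>X \<omega>\<bar>"
      by (intro AE_I2 tendsto_indicator_window)
    show "(\<lambda>N. expectation (\<lambda>\<omega>. real_of_int \<bar>X \<omega>\<bar> * indicator {- int N..int N} (X \<omega>)))
        \<longlonglongrightarrow> (\<Sum>n. real n * ?p (int n) + real n * ?p (- int n))"
      using lim by (subst integral_window(2)[OF X, of _ "\<lambda>k. real_of_int \<bar>k\<bar>"])
        (simp_all only: fold finite_atLeastAtMost_int)
    show "(\<lambda>\<omega>. real_of_int \<bar>X \<omega>\<bar>) \<in> borel_measurable M" by measurable
  qed
  then have "integrable M (\<lambda>\<omega>. norm (real_of_int (X \<omega>)))" by simp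
  then show ?thesis by (subst (asm) integrable_norm_iff) measurable
qed

lemma cdf_step:
  fixes X :: "'a \<Rightarrow> int"
  assumes [measurable]: "X \<in> measurable M (count_space UNIV)"
  shows "prob {\<omega> \<in> space M. X \<omega> \<le> k} = prob {\<omega> \<in> space M. X \<omega> \<le> k - 1} + int_pmf M X k"
proof -
  have "{\<omega> \<in> space M. X \<omega> \<le> k} = {\<omega> \<in> space M. X \<omega> \<le> k - 1} \<union> {\<omega> \<in> space M. X \<omega> = k}"
    by auto
  then show ?thesis unfolding int_pmf_def by (simp, subst finite_measure_Union) auto
qed

lemma cdf_mono:
  fixes X :: "'a \<Rightarrow> int"
  assumes [measurable]: "X \<in> measurable M (count_space UNIV)" and "j \<le> k"
  shows "prob {\<omega> \<in> space M. X \<omega> \<le> j} \<le> prob {\<omega> \<in> space M. X \<omega> \<le> k}"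
  using \<open>j \<le> k\<close> by (intro finite_measure_mono) auto

text \<open>
  Writing \<open>F (k \<plusminus> 1)\<close> in terms of \<open>F k\<close>, log-concavity of the distribution function \<open>F\<close> at \<open>k\<close>
  amounts to \<open>p (k + 1) * F (k - 1) \<le> p k * F k\<close>, which is the sum over \<open>l \<le> k - 1\<close> of the ratio
  inequalities for \<open>p\<close>.
\<close>

lemma log_concave_cdf:
  fixes X :: "'a \<Rightarrow> int"
  assumes X [measurable]: "X \<in> measurable M (count_space UNIV)"
    and dlc: "discrete_log_concave M X"
  defines "F \<equiv> \<lambda>k. prob {\<omega> \<in> space M. X \<omega> \<le> k}"
  shows "F (k - 1) * F (k + 1) \<le> (F k)\<^sup>2"
proof -
  let ?p = "int_pmf M X"
  have bound: "(\<Sum>l\<in>{- int N..int N}. indicator {..k - 1} l * ?p l) * ?p (k + 1) \<le> ?p k * F k" for N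
  proof -
    let ?S = "{- int N..int N} \<inter> {..k - 1}"
    have "(\<Sum>l\<in>{- int N..int N}. indicator {..k - 1} l * ?p l) = (\<Sum>l\<in>?S. ?p l)"
      unfolding sum.inter_restrict[OF finite_atLeastAtMost_int]
      by (intro sum.cong) (simp_all add: indicator_def)
    then have "(\<Sum>l\<in>{- int N..int N}. indicator {..k - 1} l * ?p l) * ?p (k + 1)
        = (\<Sum>l\<in>?S. ?p l * ?p (k + 1))"
      by (simp add: sum_distrib_right)
    also have "\<dots> \<le> (\<Sum>l\<in>?S. ?p (l + 1) * ?p k)"
      by (intro sum_mono int_pmf_ratio dlc) auto
    also have "\<dots> = (\<Sum>l\<in>(\<lambda>l. l + 1) ` ?S. ?p l) * ?p k"
      by (subst sum.reindex) (auto simp: sum_distrib_right)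
    also have "\<dots> \<le> prob {\<omega> \<in> space M. X \<omega> \<in> (\<lambda>l. l + 1) ` ?S} * ?p k"
      by (intro mult_right_mono int_pmf_sum_le_prob int_pmf_nonneg X) auto
    also have "\<dots> \<le> F k * ?p k"
      unfolding F_def by (intro mult_right_mono finite_measure_mono int_pmf_nonneg) auto
    finally show ?thesis by (simp add: mult.commute)
  qed
  have "expectation (\<lambda>\<omega>. indicat_real {..k - 1} (X \<omega>))
      = expectation (indicat_real {\<omega> \<in> space M. X \<omega> \<le> k - 1})"
    by (intro Bochner_Integration.integral_cong) (auto simp: indicator_def)
  then have "expectation (\<lambda>\<omega>. indicator {..k - 1} (X \<omega>)) = F (k - 1)"
    by (simp add: F_def)
  moreover have "integrable M (\<lambda>\<omega>. indicator {..k - 1} (X \<omega>) :: real)"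
    by (intro integrable_const_bound[where B = 1]) (auto simp: indicator_def)
  ultimately have "(\<lambda>N. \<Sum>l\<in>{- int N..int N}. indicator {..k - 1} l * ?p l) \<longlonglongrightarrow> F (k - 1)"
    using tendsto_sum_window[OF X, of "indicator {..k - 1}"] by simp
  then have "(\<lambda>N. (\<Sum>l\<in>{- int N..int N}. indicator {..k - 1} l * ?p l) * ?p (k + 1))
      \<longlonglongrightarrow> F (k - 1) * ?p (k + 1)"
    by (rule tendsto_mult_right)
  then have key: "F (k - 1) * ?p (k + 1) \<le> ?p k * F k"
    by (rule LIMSEQ_le_const2) (use bound in blast)
  have "F k = F (k - 1) + ?p k" "F (k + 1) = F k + ?p (k + 1)"
    using cdf_step[OF X, of k] cdf_step[OF X, of "k + 1"] by (simp_all add: F_def)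
  with key show ?thesis by (simp add: power2_eq_square algebra_simps)
qed

lemma cdf_tendsto:
  fixes X :: "'a \<Rightarrow> int"
  assumes [measurable]: "X \<in> measurable M (count_space UNIV)"
  shows "(\<lambda>N. prob {\<omega> \<in> space M. X \<omega> \<le> int N}) \<longlonglongrightarrow> 1"
    and "(\<lambda>N. prob {\<omega> \<in> space M. X \<omega> \<le> - int N - 1}) \<longlonglongrightarrow> 0"
proof -
  have "(\<lambda>N. prob {\<omega> \<in> space M. X \<omega> \<le> int N}) \<longlonglongrightarrow> prob (\<Union>N. {\<omega> \<in> space M. X \<omega> \<le> int N})"
    by (intro finite_Lim_measure_incseq) (auto simp: incseq_def)
  moreover have "(\<Union>N. {\<omega> \<in> space M. X \<omega> \<le> int N}) = space M"
  proof -
    have "X \<omega> \<le> int (nat (X \<omega>))" for \<omega> by simp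
    then show ?thesis by blast
  qed
  ultimately show "(\<lambda>N. prob {\<omega> \<in> space M. X \<omega> \<le> int N}) \<longlonglongrightarrow> 1"
    by (simp add: prob_space)
  have "(\<lambda>N. prob {\<omega> \<in> space M. X \<omega> \<le> - int N - 1})
      \<longlonglongrightarrow> prob (\<Inter>N. {\<omega> \<in> space M. X \<omega> \<le> - int N - 1})"
    by (intro finite_Lim_measure_decseq) (auto simp: decseq_def)
  moreover have "(\<Inter>N. {\<omega> \<in> space M. X \<omega> \<le> - int N - 1}) = {}"
  proof -
    have "\<not> X \<omega> \<le> - int (nat \<bar>X \<omega>\<bar>) - 1" for \<omega> by simp
    then show ?thesis by blast
  qed
  ultimately show "(\<lambda>N. prob {\<omega> \<in> space M. X \<omega> \<le> - int N - 1}) \<longlonglongrightarrow> 0"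
    by simp
qed

text \<open>
  If \<open>X > m\<close> almost surely, then integrality pushes \<open>X\<close> up to \<open>m + 1\<close>, and its mean with it.
\<close>

lemma cdf_at_mean_pos:
  fixes X :: "'a \<Rightarrow> int"
  assumes [measurable]: "X \<in> measurable M (count_space UNIV)"
    and int: "integrable M (\<lambda>\<omega>. real_of_int (X \<omega>))"
    and mean: "expectation (\<lambda>\<omega>. real_of_int (X \<omega>)) = real_of_int m"
  shows "0 < prob {\<omega> \<in> space M. X \<omega> \<le> m}"
proof (rule ccontr)
  assume "\<not> ?thesis"
  then have "prob {\<omega> \<in> space M. X \<omega> \<le> m} = 0"
    using measure_nonneg[of M "{\<omega> \<in> space M. X \<omega> \<le> m}"] by linarith
  then have "AE \<omega> in M. \<not> X \<omega> \<le> m"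
    by (subst (asm) prob_eq_0) auto
  then have "AE \<omega> in M. real_of_int (m + 1) \<le> real_of_int (X \<omega>)"
    by eventually_elim linarith
  then have "real_of_int (m + 1) \<le> expectation (\<lambda>\<omega>. real_of_int (X \<omega>))"
    by (intro integral_ge_const int)
  with mean show False by simp
qed

end

section \<open>The probability of not exceeding an integer mean\<close>

theorem corollary1p4:
  fixes M :: "'a measure" and X :: "'a \<Rightarrow> int"
  assumes "prob_space M"
    and "X \<in> measurable M (count_space UNIV)"
    and "discrete_log_concave M X"
    and "(\<integral>\<omega>. real_of_int (X \<omega>) \<partial>M) \<in> \<int>"
  shows "measure M {\<omega> \<in> space M. real_of_int (X \<omega>) \<le> (\<integral>\<omega>. real_of_int (X \<omega>) \<partial>M)} \<ge> exp (- 1)"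
proof -
  interpret prob_space M by fact
  note X = assms(2) and dlc = assms(3)
  let ?p = "int_pmf M X"
  define F where "F = (\<lambda>k. prob {\<omega> \<in> space M. X \<omega> \<le> k})"
  define G where "G = (\<lambda>u::real. u * ln u - u)"
  obtain m where mean: "expectation (\<lambda>\<omega>. real_of_int (X \<omega>)) = real_of_int m"
    using assms(4) by (elim Ints_cases)
  have int: "integrable M (\<lambda>\<omega>. real_of_int (X \<omega>))"
    by (rule log_concave_integrable[OF X dlc])

  have F_nonneg: "0 \<le> F k" for k by (simp add: F_def)
  have F_step: "F k = F (k - 1) + ?p k" for k
    unfolding F_def by (rule cdf_step[OF X])
  have F_mono: "F j \<le> F k" if "j \<le> k" for j k
    unfolding F_def by (rule cdf_mono[OF X that])
  have Fm: "0 < F m"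
    unfolding F_def by (rule cdf_at_mean_pos[OF X int mean])
  have "consecutive_ints {k. 0 < F k}"
    unfolding consecutive_ints_def using F_mono by (force intro: less_le_trans)
  then have "F l * F (k + 1) \<le> F (l + 1) * F k" if "l \<le> k" for l k
    using that log_concave_cdf[OF X dlc] F_nonneg by (intro log_concave_ratio) (auto simp: F_def)
  moreover have "0 < F (m + 1)" using Fm F_mono[of m "m + 1"] by linarith
  ultimately obtain c where line: "\<And>k. F k \<le> F m * exp (c * real_of_int (k - m))"
    using log_concave_supporting_line[of F m] Fm by blast

  have window: "G (F (int N)) - G (F (- int N - 1))
      \<le> (\<Sum>k\<in>{- int N..int N}. (ln (F m) + c * (real_of_int k - real_of_int m)) * ?p k)" for N
  proof -
    have term_le: "G (F k) - G (F (k - 1)) \<le> (ln (F m) + c * (real_of_int k - real_of_int m)) * ?p k" for k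
    proof (cases "F k = 0")
      case True
      \<comment> \<open>To the left of the support there is no logarithm to compare, but also no mass.\<close>
      then have "F (k - 1) = 0" "?p k = 0"
        using F_step[of k] F_nonneg[of "k - 1"] int_pmf_nonneg[of X k] by linarith+
      with True show ?thesis by simp
    next
      case False
      then have pos: "0 < F k" using F_nonneg[of k] by simp
      have "G (F k) - G (F (k - 1)) \<le> (F k - F (k - 1)) * ln (F k)"
        unfolding G_def by (intro ln_upper_rectangle F_nonneg F_mono) simp
      also have "\<dots> = ln (F k) * ?p k" using F_step[of k] by simp
      also have "\<dots> \<le> (ln (F m) + c * (real_of_int k - real_of_int m)) * ?p k"
      proof (intro mult_right_mono int_pmf_nonneg)
        have "ln (F k) \<le> ln (F m * exp (c * real_of_int (k - m)))"
          using pos line[of k] Fm by simp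
        then show "ln (F k) \<le> ln (F m) + c * (real_of_int k - real_of_int m)"
          using Fm by (simp add: ln_mult)
      qed
      finally show ?thesis .
    qed
    have telescope: "(\<Sum>k\<in>{- int N..int N}. G (F k) - G (F (k - 1))) = G (F (int N)) - G (F (- int N - 1))"
      by (rule sum_int_telescope) simp
    show ?thesis unfolding telescope[symmetric] by (intro sum_mono term_le)
  qed

  have "(\<lambda>N. G (F (int N)) - G (F (- int N - 1))) \<longlonglongrightarrow> (1 * ln 1 - 1) - (0 - 0)"
    unfolding G_def using cdf_tendsto[OF X] F_nonneg
    by (intro tendsto_diff tendsto_mult tendsto_ln tendsto_times_ln_at_0) (auto simp: F_def)
  moreover have "(\<lambda>N. \<Sum>k\<in>{- int N..int N}. (ln (F m) + c * (real_of_int k - real_of_int m)) * ?p k)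
      \<longlonglongrightarrow> expectation (\<lambda>\<omega>. ln (F m) + c * (real_of_int (X \<omega>) - real_of_int m))"
    using int by (intro tendsto_sum_window X) auto
  moreover have "expectation (\<lambda>\<omega>. ln (F m) + c * (real_of_int (X \<omega>) - real_of_int m)) = ln (F m)"
    using int by (simp add: mean prob_space)
  ultimately have "- 1 \<le> ln (F m)"
    using window by (auto intro: LIMSEQ_le)
  then have "exp (- 1) \<le> F m"
    using Fm by (simp add: ln_ge_iff)
  then show ?thesis by (simp add: mean F_def)
qed

end
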